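(* Let $c=(c_1,c_2,c_3,c_4)$ be a generic (symbolic) row vector and let $P,Q,R\in\mathcal{S}_4$ be such that in the symbolic matrix with rows $c,cP,cQ,cR$ no symbol is repeated in any column. Then every matrix $A\in[\mathcal{M}(c;P,Q,R)]$ belongs to $\bigcup_{i=1}^{6}\mathcal{C}_i$, where $\mathcal{C}_1,\dots,\mathcal{C}_6$ are the explicitly listed classes in the context.
   Context: A real matrix is doubly stochastic if its entries are nonnegative and every row and column sums to $1$. $\mathcal{S}_4$ is the group of $4\times4$ permutation matrices; a permutation $\pi\in S_4$ is identified with the matrix $P$ with $P_{ij}=1$ if $j=\pi(i)$ and $0$ otherwise. Vectors are row vectors. For $P,Q,R\in\mathcal{S}_4$, $\mathcal{M}(c;P,Q,R)$ denotes the set of all doubly stochastic $4\times 4$ matrices whose rows are, in order, $c,cP,cQ,cR$, where the row vector $c=(c_1,c_2,c_3,c_4)$ is allowed to vary; $[\mathcal{M}(c;P,Q,R)]=\{A\in\mathcal{M}(cX;P,Q,R):X\in\mathcal{S}_4\}$. Each $\mathcal{C}_i$ ($1\le i\le 6$) is the union of the sets $[\mathcal{M}(c;P,Q,R)]$ over the following triples $(P,Q,R)$. $\mathcal{C}_1$: $((12)(34),(1324),(1423))$; $((1243),(1342),(14)(23))$; $((1234),(13)(24),(1432))$. $\mathcal{C}_2$: $((12)(34),(14)(23),(13)(24))$; $((13)(24),(12)(34),(14)(23))$; $((14)(23),(13)(24),(12)(34))$. $\mathcal{C}_3$: $((1432),(1234),(13)(24))$; $((1342),(14)(23),(1243))$;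 $((1243),(14)(23),(1342))$; $((13)(24),(1432),(1234))$; $((13)(24),(1234),(1432))$; $((1423),(12)(34),(1324))$; $((1423),(1324),(12)(34))$; $((1234),(1432),(13)(24))$; $((1324),(12)(34),(1423))$; $((14)(23),(1243),(1342))$; $((1324),(1423),(12)(34))$; $((14)(23),(1342),(1243))$. $\mathcal{C}_4$: $((13)(24),(14)(23),(12)(34))$; $((14)(23),(12)(34),(13)(24))$. $\mathcal{C}_5$: $((12)(34),(13)(24),(14)(23))$. $\mathcal{C}_6$: $((12)(34),(1423),(1324))$; $((1432),(13)(24),(1234))$; $((1342),(1243),(14)(23))$. *)

theory Defs
  imports "HOL-Analysis.Analysis" "HOL-Combinatorics.Cycles"
begin

definition doubly_stochastic :: "real^'n^'n \<Rightarrow> bool" where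
  "doubly_stochastic A \<longleftrightarrow>
     (\<forall>i j. 0 \<le> A $ i $ j) \<and> (\<forall>i. (\<Sum>j\<in>UNIV. A $ i $ j) = 1) \<and> (\<forall>j. (\<Sum>i\<in>UNIV. A $ i $ j) = 1)"

text \<open>The index set is the numeral type \<open>4\<close>, whose elements are \<open>1, 2, 3, 4\<close>; arithmetic on it is
  modulo four, so \<open>4 = 0\<close>. With the convention below, \<open>(c v* perm_matrix \<pi>) $ \<pi> i = c $ i\<close>.\<close>

definition perm_matrix :: "('n \<Rightarrow> 'n) \<Rightarrow> real^'n^'n" where
  "perm_matrix \<pi> = (\<chi> i j. if j = \<pi> i then 1 else 0)"

definition S4 :: "(real^4^4) set" where
  "S4 = {perm_matrix \<pi> | \<pi>. \<pi> permutes UNIV}"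

definition rows_matrix :: "real^4 \<Rightarrow> real^4^4 \<Rightarrow> real^4^4 \<Rightarrow> real^4^4 \<Rightarrow> real^4^4" where
  "rows_matrix c P Q R = vector [c, c v* P, c v* Q, c v* R]"

text \<open>The first argument \<open>v\<close> expresses the first row in terms of the varying vector \<open>c\<close>:
  \<open>\<M>(c;P,Q,R)\<close> is \<open>M_set (\<lambda>c. c) P Q R\<close>, and \<open>\<M>(cX;P,Q,R)\<close> is \<open>M_set (\<lambda>c. c v* X) P Q R\<close>.\<close>

definition M_set ::
  "(real^4 \<Rightarrow> real^4) \<Rightarrow> real^4^4 \<Rightarrow> real^4^4 \<Rightarrow> real^4^4 \<Rightarrow> (real^4^4) set" where
  "M_set v P Q R = {A. doubly_stochastic A \<and> (\<exists>c. A = rows_matrix (v c) P Q R)}"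

definition M_class :: "real^4^4 \<Rightarrow> real^4^4 \<Rightarrow> real^4^4 \<Rightarrow> (real^4^4) set" where
  "M_class P Q R = {A. \<exists>X\<in>S4. A \<in> M_set (\<lambda>c. c v* X) P Q R}"

text \<open>For generic \<open>c\<close> the symbols \<open>c\<^sub>1, \<dots>, c\<^sub>4\<close> are the four coordinate functions on \<open>\<real>\<^sup>4\<close>; every entry
  of the symbolic matrix with rows \<open>c, cP, cQ, cR\<close> is then a function of \<open>c\<close>, and two entries carry the
  same symbol iff they are equal as functions of \<open>c\<close>.\<close>

definition symbolic_entry ::
  "real^4^4 \<Rightarrow> real^4^4 \<Rightarrow> real^4^4 \<Rightarrow> 4 \<Rightarrow> 4 \<Rightarrow> (real^4 \<Rightarrow> real)" where
  "symbolic_entry P Q R i j = (\<lambda>c. rows_matrix c P Q R $ i $ j)"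

definition no_column_repetition :: "real^4^4 \<Rightarrow> real^4^4 \<Rightarrow> real^4^4 \<Rightarrow> bool" where
  "no_column_repetition P Q R \<longleftrightarrow> (\<forall>j. inj (\<lambda>i. symbolic_entry P Q R i j))"

definition class_union :: "((4 \<Rightarrow> 4) \<times> (4 \<Rightarrow> 4) \<times> (4 \<Rightarrow> 4)) set \<Rightarrow> (real^4^4) set" where
  "class_union T = (\<Union>(p, q, r)\<in>T. M_class (perm_matrix p) (perm_matrix q) (perm_matrix r))"

abbreviation cyc :: "4 list \<Rightarrow> 4 \<Rightarrow> 4" where
  "cyc \<equiv> cycle_of_list"

definition C1 :: "(real^4^4) set" where
  "C1 = class_union
   {(cyc [1, 2] \<circ> cyc [3, 4], cyc [1, 3, 2, 4], cyc [1, 4, 2, 3]),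
    (cyc [1, 2, 4, 3], cyc [1, 3, 4, 2], cyc [1, 4] \<circ> cyc [2, 3]),
    (cyc [1, 2, 3, 4], cyc [1, 3] \<circ> cyc [2, 4], cyc [1, 4, 3, 2])}"

definition C2 :: "(real^4^4) set" where
  "C2 = class_union
   {(cyc [1, 2] \<circ> cyc [3, 4], cyc [1, 4] \<circ> cyc [2, 3], cyc [1, 3] \<circ> cyc [2, 4]),
    (cyc [1, 3] \<circ> cyc [2, 4], cyc [1, 2] \<circ> cyc [3, 4], cyc [1, 4] \<circ> cyc [2, 3]),
    (cyc [1, 4] \<circ> cyc [2, 3], cyc [1, 3] \<circ> cyc [2, 4], cyc [1, 2] \<circ> cyc [3, 4])}"

definition C3 :: "(real^4^4) set" where
  "C3 = class_union
   {(cyc [1, 4, 3, 2], cyc [1, 2, 3, 4], cyc [1, 3] \<circ> cyc [2, 4]),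
    (cyc [1, 3, 4, 2], cyc [1, 4] \<circ> cyc [2, 3], cyc [1, 2, 4, 3]),
    (cyc [1, 2, 4, 3], cyc [1, 4] \<circ> cyc [2, 3], cyc [1, 3, 4, 2]),
    (cyc [1, 3] \<circ> cyc [2, 4], cyc [1, 4, 3, 2], cyc [1, 2, 3, 4]),
    (cyc [1, 3] \<circ> cyc [2, 4], cyc [1, 2, 3, 4], cyc [1, 4, 3, 2]),
    (cyc [1, 4, 2, 3], cyc [1, 2] \<circ> cyc [3, 4], cyc [1, 3, 2, 4]),
    (cyc [1, 4, 2, 3], cyc [1, 3, 2, 4], cyc [1, 2] \<circ> cyc [3, 4]),
    (cyc [1, 2, 3, 4], cyc [1, 4, 3, 2], cyc [1, 3] \<circ> cyc [2, 4]),
    (cyc [1, 3, 2, 4], cyc [1, 2] \<circ> cyc [3, 4], cyc [1, 4, 2, 3]),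
    (cyc [1, 4] \<circ> cyc [2, 3], cyc [1, 2, 4, 3], cyc [1, 3, 4, 2]),
    (cyc [1, 3, 2, 4], cyc [1, 4, 2, 3], cyc [1, 2] \<circ> cyc [3, 4]),
    (cyc [1, 4] \<circ> cyc [2, 3], cyc [1, 3, 4, 2], cyc [1, 2, 4, 3])}"

definition C4 :: "(real^4^4) set" where
  "C4 = class_union
   {(cyc [1, 3] \<circ> cyc [2, 4], cyc [1, 4] \<circ> cyc [2, 3], cyc [1, 2] \<circ> cyc [3, 4]),
    (cyc [1, 4] \<circ> cyc [2, 3], cyc [1, 2] \<circ> cyc [3, 4], cyc [1, 3] \<circ> cyc [2, 4])}"

definition C5 :: "(real^4^4) set" where
  "C5 = class_union
   {(cyc [1, 2] \<circ> cyc [3, 4], cyc [1, 3] \<circ> cyc [2, 4], cyc [1, 4] \<circ> cyc [2, 3])}"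

definition C6 :: "(real^4^4) set" where
  "C6 = class_union
   {(cyc [1, 2] \<circ> cyc [3, 4], cyc [1, 4, 2, 3], cyc [1, 3, 2, 4]),
    (cyc [1, 4, 3, 2], cyc [1, 3] \<circ> cyc [2, 4], cyc [1, 2, 3, 4]),
    (cyc [1, 3, 4, 2], cyc [1, 2, 4, 3], cyc [1, 4] \<circ> cyc [2, 3])}"

end

theory Submission
  imports Defs
begin

text \<open>
  Write \<open>P\<close>, \<open>Q\<close>, \<open>R\<close> as the matrices of permutations \<open>p\<close>, \<open>q\<close>, \<open>r\<close>. In the symbolic matrix with rows
  \<open>c, cP, cQ, cR\<close> the symbol \<open>c\<^sub>i\<close> stands in the columns \<open>i\<close>, \<open>p i\<close>, \<open>q i\<close>, \<open>r i\<close> of the four rows.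
  If no column repeats a symbol, then these four columns differ for every \<open>i\<close>: the permutations
  \<open>id\<close>, \<open>p\<close>, \<open>q\<close>, \<open>r\<close> disagree pairwise at every point, which is to say that they form a Latin square
  of order four with a fixed first row (\<open>no_column_repetition_imp_nowhere_equal\<close>).

  There are exactly 24 such triples, and they are the ones listed in the six classes. Indeed \<open>p\<close> is a
  derangement of four points, so it is a four-cycle or a product of two disjoint transpositions.
  At each point \<open>i\<close> the values \<open>q i\<close> and \<open>r i\<close> are the two points other than \<open>i\<close> and \<open>p i\<close>.

    \<^item> If \<open>p\<close> is a four-cycle, the choice of \<open>q\<close> at one point determines \<open>q\<close> everywhere, and
      \<open>q\<close>, \<open>r\<close> are \<open>p\<^sup>2\<close>, \<open>p\<^sup>3\<close> in either order (\<open>four_cycle_completions\<close>). The six four-cycles give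
      12 triples.
    \<^item> If \<open>p\<close> is a double transposition, then \<open>q\<close> exchanges the two orbits of \<open>p\<close>, in one of four ways,
      and \<open>r = q \<circ> p\<close> (\<open>double_transposition_completions\<close>). The three double transpositions give the
      other 12 triples.

  Membership of \<open>A\<close> in one of the classes thus rests on the triple \<open>(p, q, r)\<close> alone; the entries of
  \<open>A\<close> and its first row \<open>cX\<close> are carried along unchanged.
\<close>

lemma fun_eq_iff_4: "f = g \<longleftrightarrow> f 1 = g 1 \<and> f 2 = g 2 \<and> f 3 = g 3 \<and> f 4 = g 4"
  for f g :: "4 \<Rightarrow> 'a"
  by (simp add: fun_eq_iff forall_4)

lemma row_vector_perm_matrix_nth:
  assumes "inj \<pi>"
  shows "(c v* perm_matrix \<pi>) $ \<pi> i = c $ i"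
proof -
  have "(c v* perm_matrix \<pi>) $ \<pi> i = (\<Sum>k\<in>UNIV. if i = k then c $ k else 0)"
    using assms by (simp add: vector_matrix_mult_def perm_matrix_def inj_eq if_distrib cong: if_cong)
  then show ?thesis
    by simp
qed

lemma rows_matrix_nth:
  "rows_matrix c P Q R $ 1 = c" "rows_matrix c P Q R $ 2 = c v* P"
  "rows_matrix c P Q R $ 3 = c v* Q" "rows_matrix c P Q R $ 4 = c v* R"
  by (simp_all add: rows_matrix_def vector_def)

text \<open>Distinct rows of a Latin square, read as permutations, stand in this relation; a permutation in
  this relation to \<open>id\<close> is a derangement.\<close>

definition nowhere_equal :: "('a \<Rightarrow> 'b) \<Rightarrow> ('a \<Rightarrow> 'b) \<Rightarrow> bool"
  where "nowhere_equal f g \<longleftrightarrow> (\<forall>x. f x \<noteq> g x)"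

text \<open>If two of the four permutations sent \<open>i\<close> to the same \<open>j\<close>, then the coordinate function \<open>c\<^sub>i\<close>
  would occur twice in column \<open>j\<close>.\<close>

lemma no_column_repetition_imp_nowhere_equal:
  assumes rep: "no_column_repetition (perm_matrix p) (perm_matrix q) (perm_matrix r)"
    and inj: "inj p" "inj q" "inj r"
  shows "nowhere_equal p id" "nowhere_equal q id" "nowhere_equal r id"
    "nowhere_equal p q" "nowhere_equal p r" "nowhere_equal q r"
proof -
  \<comment> \<open>Named as opaque functions, so that what follows is first-order equational reasoning.\<close>
  define s where "s = symbolic_entry (perm_matrix p) (perm_matrix q) (perm_matrix r)"
  define coord :: "4 \<Rightarrow> real^4 \<Rightarrow> real" where "coord i = (\<lambda>c. c $ i)" for i
  have sym: "s 1 i = coord i" "s 2 (p i) = coord i" "s 3 (q i) = coord i" "s 4 (r i) = coord i" for i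
    using inj by (simp_all add: s_def coord_def symbolic_entry_def rows_matrix_nth
        row_vector_perm_matrix_nth)
  have "s k j = s l j \<longleftrightarrow> k = l" for k l j
    using rep inj_eq[of "\<lambda>i. s i j" k l] by (simp add: no_column_repetition_def s_def)
  then have diff: "s 1 j \<noteq> s 2 j" "s 1 j \<noteq> s 3 j" "s 1 j \<noteq> s 4 j"
    "s 2 j \<noteq> s 3 j" "s 2 j \<noteq> s 4 j" "s 3 j \<noteq> s 4 j" for j
    by simp_all
  show "nowhere_equal p id" "nowhere_equal q id" "nowhere_equal r id"
    "nowhere_equal p q" "nowhere_equal p r" "nowhere_equal q r"
    unfolding nowhere_equal_def id_apply by (metis diff sym)+
qed

text \<open>The two points that \<open>q\<close> may take at \<open>x\<close> are \<open>p (p x)\<close> and \<open>p (p (p x))\<close>. If \<open>q\<close>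
  used both rules, then somewhere along the cycle a point \<open>x\<close> of the second rule would precede a point
  \<open>p x\<close> of the first, and \<open>q x = p (p (p x)) = q (p x)\<close>. Hence \<open>q\<close> follows one rule throughout, and \<open>r\<close>
  the other.\<close>

lemma four_cycle_completions:
  assumes "UNIV = {a, b, c, d}" "distinct [a, b, c, d]"
    and "p a = b" "p b = c" "p c = d" "p d = a"
    and "inj q"
    and "nowhere_equal q id" "nowhere_equal r id"
      "nowhere_equal p q" "nowhere_equal p r" "nowhere_equal q r"
  shows "q = p \<circ> p \<and> r = p \<circ> p \<circ> p \<or> q = p \<circ> p \<circ> p \<and> r = p \<circ> p"
proof -
  have all: "(\<forall>x. A x) \<longleftrightarrow> A a \<and> A b \<and> A c \<and> A d" for A
    using assms(1) by (metis UNIV_I empty_iff insert_iff)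
  have val: "x = a \<or> x = b \<or> x = c \<or> x = d" for x
    using assms(1) by auto
  have q: "q a = c \<or> q a = d" "q b = d \<or> q b = a" "q c = a \<or> q c = b" "q d = b \<or> q d = c"
    and r: "r a = c \<or> r a = d" "r b = d \<or> r b = a" "r c = a \<or> r c = b" "r d = b \<or> r d = c"
    using assms(3-) val by (metis nowhere_equal_def id_apply)+
  have dist: "q a \<noteq> q b" "q b \<noteq> q c" "q c \<noteq> q d" "q d \<noteq> q a"
    using assms(2,7) by (auto simp: inj_eq)
  have qr: "q a \<noteq> r a" "q b \<noteq> r b" "q c \<noteq> r c" "q d \<noteq> r d"
    using assms(12) by (auto simp: nowhere_equal_def)
  show ?thesis
    unfolding fun_eq_iff all using q r dist qr assms(2-6) by (simp; metis)
qed

text \<open>Since \<open>q x\<close> and \<open>r x\<close> avoid \<open>{x, p x}\<close>, they fill the other orbit of \<open>p\<close>. So \<open>q\<close> maps \<open>{a, b}\<close> onto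
  \<open>{c, d}\<close> and vice versa, with two independent choices, and \<open>r x\<close> is the point of that orbit which
  \<open>q\<close> does not take at \<open>x\<close>, namely \<open>q (p x)\<close>.\<close>

lemma double_transposition_completions:
  assumes "UNIV = {a, b, c, d}" "distinct [a, b, c, d]"
    and "p a = b" "p b = a" "p c = d" "p d = c"
    and "inj q"
    and "nowhere_equal q id" "nowhere_equal r id"
      "nowhere_equal p q" "nowhere_equal p r" "nowhere_equal q r"
  shows "(q a = c \<and> q b = d \<or> q a = d \<and> q b = c) \<and>
    (q c = a \<and> q d = b \<or> q c = b \<and> q d = a) \<and> r = q \<circ> p"
proof -
  have all: "(\<forall>x. A x) \<longleftrightarrow> A a \<and> A b \<and> A c \<and> A d" for A
    using assms(1) by (metis UNIV_I empty_iff insert_iff)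
  have val: "x = a \<or> x = b \<or> x = c \<or> x = d" for x
    using assms(1) by auto
  have q: "q a = c \<or> q a = d" "q b = c \<or> q b = d" "q c = a \<or> q c = b" "q d = a \<or> q d = b"
    and r: "r a = c \<or> r a = d" "r b = c \<or> r b = d" "r c = a \<or> r c = b" "r d = a \<or> r d = b"
    using assms(3-) val by (metis nowhere_equal_def id_apply)+
  have dist: "q a \<noteq> q b" "q c \<noteq> q d"
    using assms(2,7) by (auto simp: inj_eq)
  have qr: "q a \<noteq> r a" "q b \<noteq> r b" "q c \<noteq> r c" "q d \<noteq> r d"
    using assms(12) by (auto simp: nowhere_equal_def)
  show ?thesis
    unfolding fun_eq_iff all using q r dist qr assms(2-6) by (simp; metis)
qed

text \<open>These are the three double transpositions and the six four-cycles; every other cycle type on four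
  points leaves a point fixed.\<close>

lemma derangements_4:
  fixes p :: "4 \<Rightarrow> 4"
  assumes "inj p" "nowhere_equal p id"
  shows "p \<in> {cyc [1, 2] \<circ> cyc [3, 4], cyc [1, 3] \<circ> cyc [2, 4], cyc [1, 4] \<circ> cyc [2, 3],
    cyc [1, 2, 3, 4], cyc [1, 2, 4, 3], cyc [1, 3, 2, 4],
    cyc [1, 3, 4, 2], cyc [1, 4, 2, 3], cyc [1, 4, 3, 2]}"
proof -
  have vals: "p 1 = 2 \<or> p 1 = 3 \<or> p 1 = 4" "p 2 = 1 \<or> p 2 = 3 \<or> p 2 = 4"
    "p 3 = 1 \<or> p 3 = 2 \<or> p 3 = 4" "p 4 = 1 \<or> p 4 = 2 \<or> p 4 = 3"
    using exhaust_4 assms(2) by (metis nowhere_equal_def id_apply)+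
  have distinct: "p 1 \<noteq> p 2" "p 1 \<noteq> p 3" "p 1 \<noteq> p 4" "p 2 \<noteq> p 3" "p 2 \<noteq> p 4" "p 3 \<noteq> p 4"
    using assms(1) by (simp_all add: inj_eq)
  show ?thesis
    using vals distinct unfolding insert_iff empty_iff fun_eq_iff_4
    by (simp add: transpose_def) (elim disjE; simp)
qed

lemma class_unionI:
  assumes "A \<in> M_class (perm_matrix p) (perm_matrix q) (perm_matrix r)" "(p, q, r) \<in> T"
  shows "A \<in> class_union T"
  using assms by (auto simp: class_union_def)

lemma class_union_Un: "class_union (S \<union> T) = class_union S \<union> class_union T"
  by (auto simp: class_union_def)

theorem theorem2p5:
  fixes P Q R A :: "real^4^4"
  assumes "P \<in> S4" and "Q \<in> S4" and "R \<in> S4"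
    and "no_column_repetition P Q R"
    and "A \<in> M_class P Q R"
  shows "A \<in> C1 \<union> C2 \<union> C3 \<union> C4 \<union> C5 \<union> C6"
proof -
  obtain p q r where PQR: "P = perm_matrix p" "Q = perm_matrix q" "R = perm_matrix r"
    and inj: "inj p" "inj q" "inj r"
    using assms(1-3) by (auto simp: S4_def dest: permutes_inj)
  note ne = no_column_repetition_imp_nowhere_equal[OF assms(4)[unfolded PQR] inj]
  have transpositions_case: "(q a = c \<and> q b = d \<or> q a = d \<and> q b = c) \<and>
      (q c = a \<and> q d = b \<or> q c = b \<and> q d = a) \<and> r = q \<circ> p"
    if "UNIV = {a, b, c, d}" "distinct [a, b, c, d]" "p a = b" "p b = a" "p c = d" "p d = c"
    for a b c d
    using double_transposition_completions[OF that inj(2) ne(2-6)] .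
  have cycle_case: "q = p \<circ> p \<and> r = p \<circ> p \<circ> p \<or> q = p \<circ> p \<circ> p \<and> r = p \<circ> p"
    if "UNIV = {a, b, c, d}" "distinct [a, b, c, d]" "p a = b" "p b = c" "p c = d" "p d = a"
    for a b c d
    using four_cycle_completions[OF that inj(2) ne(2-6)] .
  \<comment> \<open>The orders in which the case distinction below traverses the orbits of \<open>p\<close>.\<close>
  have orders: "UNIV = {1, 2, 3, 4 :: 4}" "UNIV = {1, 3, 2, 4 :: 4}" "UNIV = {1, 4, 2, 3 :: 4}"
     "UNIV = {1, 2, 4, 3 :: 4}" "UNIV = {1, 3, 4, 2 :: 4}" "UNIV = {1, 4, 3, 2 :: 4}"
    using UNIV_4 by auto
  \<comment> \<open>The union of the six classes is the class of all 24 listed triples together.\<close>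
  show ?thesis
    unfolding C1_def C2_def C3_def C4_def C5_def C6_def class_union_Un[symmetric]
  proof (rule class_unionI[of A p q r], goal_cases)
    case 1
    show ?case
      using assms(5) PQR by simp
  next
    case 2
    from derangements_4[OF inj(1) ne(1)]
    consider "p = cyc [1, 2] \<circ> cyc [3, 4]" | "p = cyc [1, 3] \<circ> cyc [2, 4]"
      | "p = cyc [1, 4] \<circ> cyc [2, 3]" | "p = cyc [1, 2, 3, 4]" | "p = cyc [1, 2, 4, 3]"
      | "p = cyc [1, 3, 2, 4]" | "p = cyc [1, 3, 4, 2]" | "p = cyc [1, 4, 2, 3]"
      | "p = cyc [1, 4, 3, 2]"
      by blast
    then show ?case
    proof cases
      case 1
      have p: "p 1 = 2" "p 2 = 1" "p 3 = 4" "p 4 = 3"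
        by (simp_all add: 1 transpose_def)
      have "q = cyc [1, 3] \<circ> cyc [2, 4] \<and> r = cyc [1, 4] \<circ> cyc [2, 3]
        \<or> q = cyc [1, 3, 2, 4] \<and> r = cyc [1, 4, 2, 3]
        \<or> q = cyc [1, 4, 2, 3] \<and> r = cyc [1, 3, 2, 4]
        \<or> q = cyc [1, 4] \<circ> cyc [2, 3] \<and> r = cyc [1, 3] \<circ> cyc [2, 4]"
        using transpositions_case[OF orders(1) _ p] by (auto simp: p fun_eq_iff_4 transpose_def)
      with 1 show ?thesis
        by (elim disjE conjE; simp only: Un_iff insert_iff simp_thms)
    next
      case 2
      have p: "p 1 = 3" "p 3 = 1" "p 2 = 4" "p 4 = 2"
        by (simp_all add: 2 transpose_def)
      have "q = cyc [1, 2] \<circ> cyc [3, 4] \<and> r = cyc [1, 4] \<circ> cyc [2, 3]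
        \<or> q = cyc [1, 2, 3, 4] \<and> r = cyc [1, 4, 3, 2]
        \<or> q = cyc [1, 4, 3, 2] \<and> r = cyc [1, 2, 3, 4]
        \<or> q = cyc [1, 4] \<circ> cyc [2, 3] \<and> r = cyc [1, 2] \<circ> cyc [3, 4]"
        using transpositions_case[OF orders(2) _ p] by (auto simp: p fun_eq_iff_4 transpose_def)
      with 2 show ?thesis
        by (elim disjE conjE; simp only: Un_iff insert_iff simp_thms)
    next
      case 3
      have p: "p 1 = 4" "p 4 = 1" "p 2 = 3" "p 3 = 2"
        by (simp_all add: 3 transpose_def)
      have "q = cyc [1, 2] \<circ> cyc [3, 4] \<and> r = cyc [1, 3] \<circ> cyc [2, 4]
        \<or> q = cyc [1, 2, 4, 3] \<and> r = cyc [1, 3, 4, 2]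
        \<or> q = cyc [1, 3, 4, 2] \<and> r = cyc [1, 2, 4, 3]
        \<or> q = cyc [1, 3] \<circ> cyc [2, 4] \<and> r = cyc [1, 2] \<circ> cyc [3, 4]"
        using transpositions_case[OF orders(3) _ p] by (auto simp: p fun_eq_iff_4 transpose_def)
      with 3 show ?thesis
        by (elim disjE conjE; simp only: Un_iff insert_iff simp_thms)
    next
      case 4
      have p: "p 1 = 2" "p 2 = 3" "p 3 = 4" "p 4 = 1"
        by (simp_all add: 4 transpose_def)
      have "q = cyc [1, 3] \<circ> cyc [2, 4] \<and> r = cyc [1, 4, 3, 2]
        \<or> q = cyc [1, 4, 3, 2] \<and> r = cyc [1, 3] \<circ> cyc [2, 4]"
        using cycle_case[OF orders(1) _ p] by (auto simp: p fun_eq_iff_4 transpose_def)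
      with 4 show ?thesis
        by (elim disjE conjE; simp only: Un_iff insert_iff simp_thms)
    next
      case 5
      have p: "p 1 = 2" "p 2 = 4" "p 4 = 3" "p 3 = 1"
        by (simp_all add: 5 transpose_def)
      have "q = cyc [1, 3, 4, 2] \<and> r = cyc [1, 4] \<circ> cyc [2, 3]
        \<or> q = cyc [1, 4] \<circ> cyc [2, 3] \<and> r = cyc [1, 3, 4, 2]"
        using cycle_case[OF orders(4) _ p] by (auto simp: p fun_eq_iff_4 transpose_def)
      with 5 show ?thesis
        by (elim disjE conjE; simp only: Un_iff insert_iff simp_thms)
    next
      case 6
      have p: "p 1 = 3" "p 3 = 2" "p 2 = 4" "p 4 = 1"
        by (simp_all add: 6 transpose_def)
      have "q = cyc [1, 2] \<circ> cyc [3, 4] \<and> r = cyc [1, 4, 2, 3]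
        \<or> q = cyc [1, 4, 2, 3] \<and> r = cyc [1, 2] \<circ> cyc [3, 4]"
        using cycle_case[OF orders(2) _ p] by (auto simp: p fun_eq_iff_4 transpose_def)
      with 6 show ?thesis
        by (elim disjE conjE; simp only: Un_iff insert_iff simp_thms)
    next
      case 7
      have p: "p 1 = 3" "p 3 = 4" "p 4 = 2" "p 2 = 1"
        by (simp_all add: 7 transpose_def)
      have "q = cyc [1, 2, 4, 3] \<and> r = cyc [1, 4] \<circ> cyc [2, 3]
        \<or> q = cyc [1, 4] \<circ> cyc [2, 3] \<and> r = cyc [1, 2, 4, 3]"
        using cycle_case[OF orders(5) _ p] by (auto simp: p fun_eq_iff_4 transpose_def)
      with 7 show ?thesis
        by (elim disjE conjE; simp only: Un_iff insert_iff simp_thms)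
    next
      case 8
      have p: "p 1 = 4" "p 4 = 2" "p 2 = 3" "p 3 = 1"
        by (simp_all add: 8 transpose_def)
      have "q = cyc [1, 2] \<circ> cyc [3, 4] \<and> r = cyc [1, 3, 2, 4]
        \<or> q = cyc [1, 3, 2, 4] \<and> r = cyc [1, 2] \<circ> cyc [3, 4]"
        using cycle_case[OF orders(3) _ p] by (auto simp: p fun_eq_iff_4 transpose_def)
      with 8 show ?thesis
        by (elim disjE conjE; simp only: Un_iff insert_iff simp_thms)
    next
      case 9
      have p: "p 1 = 4" "p 4 = 3" "p 3 = 2" "p 2 = 1"
        by (simp_all add: 9 transpose_def)
      have "q = cyc [1, 2, 3, 4] \<and> r = cyc [1, 3] \<circ> cyc [2, 4]
        \<or> q = cyc [1, 3] \<circ> cyc [2, 4] \<and> r = cyc [1, 2, 3, 4]"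
        using cycle_case[OF orders(6) _ p] by (auto simp: p fun_eq_iff_4 transpose_def)
      with 9 show ?thesis
        by (elim disjE conjE; simp only: Un_iff insert_iff simp_thms)
    qed
  qed
qed

end
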